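(* Let $X$ and $Y$ be non-zero real Banach spaces and let $H$ be a closed linear subspace of $K(Y^*,X)$ such that $X\otimes Y\subseteq H$. If $X$ is unconditionally almost square (UASQ), then $H$ is UASQ.
   Context: All Banach spaces are real; $S_Z$ denotes the unit sphere of a Banach space $Z$. $K(Y^*,X)$ is the space of compact linear operators from $Y^*$ to $X$ with the operator norm. The algebraic tensor product $X\otimes Y$ is identified with a subspace of $K(Y^*,X)$, where $x\otimes y$ is the operator $y^*\mapsto y^*(y)\,x$, extended linearly. A Banach space $Z$ is called unconditionally almost square (UASQ) if for each $\varepsilon>0$ there exists a subset $\{x_\gamma\}_{\gamma\in\Gamma}\subseteq S_Z$ (depending on $\varepsilon$) such that: (1) for each finite set $\{y_1,\ldots,y_k\}\subseteq S_Z$ and each $\delta>0$ the set $\{\gamma\in\Gamma : \|y_i\pm x_\gamma\|\le 1+\delta\ \text{for all } i\in\{1,\ldots,k\}\}$ is non-empty; (2) for every finite subset $F$ of $\Gamma$ and every choice of signs $\xi_\gamma\in\{-1,1\}$, $\gamma\in F$, one has $\left\|\sum_{\gamma\in F}\xi_\gamma x_\gamma\right\|\le 1+\varepsilon$. *)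

theory Defs
  imports "HOL-Analysis.Analysis"
begin

text \<open>A Banach space is presented as a closed linear subspace \<open>Z\<close> of an ambient normed space, with
  the inherited norm; a space given by a whole type is the case \<open>Z = UNIV\<close>.\<close>

definition unit_sphere :: "'z::real_normed_vector set \<Rightarrow> 'z set" where
  "unit_sphere Z = {z \<in> Z. norm z = 1}"

text \<open>The set \<open>{x\<^sub>\<gamma>}\<close> is indexed by its own elements. This loses nothing compared with families with
  repetitions: a member occurring twice would give \<open>\<parallel>x + x\<parallel> = 2\<close>, so the second condition excludes
  repetitions when \<open>\<epsilon> < 1\<close>, and a set that works for some \<open>\<epsilon>\<close> works for all larger ones.\<close>

definition uasq :: "'z::real_normed_vector set \<Rightarrow> bool" where
  "uasq Z \<longleftrightarrow> (\<forall>\<epsilon>>0. \<exists>A \<subseteq> unit_sphere Z.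
     (\<forall>F \<delta>. finite F \<and> F \<noteq> {} \<and> F \<subseteq> unit_sphere Z \<and> \<delta> > 0 \<longrightarrow>
        {x \<in> A. \<forall>y\<in>F. norm (y + x) \<le> 1 + \<delta> \<and> norm (y - x) \<le> 1 + \<delta>} \<noteq> {}) \<and>
     (\<forall>F \<xi>. finite F \<and> F \<subseteq> A \<and> (\<forall>x\<in>F. \<xi> x \<in> {-1, 1 :: real}) \<longrightarrow>
        norm (\<Sum>x\<in>F. \<xi> x *\<^sub>R x) \<le> 1 + \<epsilon>))"

definition compact_operators :: "('a::real_normed_vector \<Rightarrow>\<^sub>L 'b::real_normed_vector) set" where
  "compact_operators = {T. compact (closure (blinfun_apply T ` cball 0 1))}"

type_synonym 'b dual = "'b \<Rightarrow>\<^sub>L real"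

lift_definition elementary_tensor ::
    "'a::real_normed_vector \<Rightarrow> 'b::real_normed_vector \<Rightarrow> 'b dual \<Rightarrow>\<^sub>L 'a"
  is "\<lambda>x y f. blinfun_apply f y *\<^sub>R x"
  by (intro bounded_linear_scaleR_const bounded_linear_blinfun_apply blinfun.bounded_linear_left)

definition algebraic_tensor ::
    "'a::real_normed_vector set \<Rightarrow> 'b::real_normed_vector set \<Rightarrow> ('b dual \<Rightarrow>\<^sub>L 'a) set" where
  "algebraic_tensor X Y = span {elementary_tensor x y |x y. x \<in> X \<and> y \<in> Y}"

end

theory Submission imports Defs begin

text \<open>Fix \<open>\<epsilon>\<close>, let \<open>A\<close> witness that \<open>X\<close> is UASQ for \<open>\<epsilon>\<close>, and fix \<open>y \<in> Y\<close> for which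
  \<open>x \<mapsto> x \<otimes> y\<close> is an isometry of \<open>X\<close> into \<open>H\<close>; the witness in \<open>H\<close> is the image of \<open>A\<close>.
  The bound on signed sums is preserved by isometries. For the other condition,
  \<open>(T \<plusminus> x \<otimes> y)(f) = T f \<plusminus> f(y) x\<close>, where \<open>\<bar>f(y)\<bar> \<le> 1\<close> for \<open>\<parallel>f\<parallel> \<le> 1\<close>. As finitely many
  compact operators \<open>T\<close> of norm one map the dual unit ball into a single compact subset of the
  unit ball of \<open>X\<close>, it suffices that some \<open>x \<in> A\<close> satisfies \<open>\<parallel>z + t x\<parallel> \<le> 1 + \<delta>\<close> for all \<open>z\<close> in
  that set and all \<open>\<bar>t\<bar> \<le> 1\<close> (\<open>almost_square_on_compact\<close>). This follows from the
  defining property of \<open>A\<close>, applied to the normalised points of a finite net, by convexity of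
  the norm (\<open>norm_add_scaled_le_of_normalised\<close>).

  Since \<open>\<parallel>x \<otimes> y\<parallel>\<close> is \<open>\<parallel>x\<parallel>\<close> times the norm of the evaluation functional at \<open>y\<close> on \<open>Y\<^sup>*\<close>
  (\<open>norm_elementary_tensor\<close>), the requirement on \<open>y\<close> is that this functional has norm one. Scaling
  any \<open>y\<close> that some \<open>f \<in> Y\<^sup>*\<close> does not annihilate achieves it. If no such \<open>y\<close> exists then
  \<open>Y\<^sup>* = 0\<close>, hence \<open>H = 0\<close>, whose unit sphere is empty, and the empty set is a witness
  vacuously.\<close>

text \<open>The function \<open>t \<mapsto> \<parallel>z + t x\<parallel>\<close> is convex, so on \<open>[-1, 1]\<close> it is largest at an endpoint,
  and for \<open>z \<noteq> 0\<close> the vector \<open>z \<plusminus> x\<close> is a convex combination of \<open>sgn z \<plusminus> x\<close> and \<open>\<plusminus>x\<close>.\<close>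

lemma norm_add_scaled_le_of_normalised:
  fixes x z :: "'a::real_normed_vector"
  assumes x: "norm x = 1" and z: "norm z \<le> 1" and t: "\<bar>t\<bar> \<le> 1" and \<delta>: "0 \<le> \<delta>"
    and sgn_z: "z \<noteq> 0 \<Longrightarrow> norm (sgn z + x) \<le> 1 + \<delta> \<and> norm (sgn z - x) \<le> 1 + \<delta>"
  shows "norm (z + t *\<^sub>R x) \<le> 1 + \<delta>"
proof -
  have endpoint: "norm (z + s *\<^sub>R x) \<le> 1 + \<delta>" if s: "s = 1 \<or> s = - 1" for s
  proof (cases "z = 0")
    case True
    then show ?thesis using s x \<delta> by auto
  next
    case False
    have "z + s *\<^sub>R x = norm z *\<^sub>R (sgn z + s *\<^sub>R x) + (1 - norm z) *\<^sub>R (s *\<^sub>R x)"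
      using False by (simp add: sgn_div_norm algebra_simps)
    also have "norm \<dots> \<le> norm z * norm (sgn z + s *\<^sub>R x) + (1 - norm z) * norm (s *\<^sub>R x)"
      using z by (intro order_trans[OF norm_triangle_ineq]) (simp add: abs_mult)
    also have "\<dots> \<le> norm z * (1 + \<delta>) + (1 - norm z) * (1 + \<delta>)"
      using sgn_z[OF False] s x z \<delta> by (intro add_mono mult_left_mono) auto
    finally show ?thesis by (simp add: algebra_simps)
  qed
  define a b where "a = (1 + t) / 2" and "b = (1 - t) / 2"
  then have ab: "a + b = 1" "a - b = t" "0 \<le> a" "0 \<le> b"
    using t by (auto simp: field_simps)
  have "z + t *\<^sub>R x = (a + b) *\<^sub>R z + (a - b) *\<^sub>R x"
    by (simp add: ab)
  also have "\<dots> = a *\<^sub>R (z + 1 *\<^sub>R x) + b *\<^sub>R (z + (- 1) *\<^sub>R x)"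
    by (simp add: algebra_simps)
  also have "norm \<dots> \<le> a * norm (z + 1 *\<^sub>R x) + b * norm (z + (- 1) *\<^sub>R x)"
    using ab by (intro order_trans[OF norm_triangle_ineq]) simp
  also have "\<dots> \<le> a * (1 + \<delta>) + b * (1 + \<delta>)"
    using ab by (intro add_mono mult_left_mono endpoint) auto
  also have "\<dots> = 1 + \<delta>"
    by (simp add: ab flip: distrib_right)
  finally show ?thesis .
qed

text \<open>A finite \<open>\<delta>/2\<close>-net reduces the compact set to finitely many unit vectors; the other half of
  \<open>\<delta>\<close> pays for replacing a point by a net point.\<close>

lemma almost_square_on_compact:
  fixes A K :: "'a::real_normed_vector set"
  assumes nontrivial: "(UNIV :: 'a set) \<noteq> {0}"
    and A: "A \<subseteq> unit_sphere UNIV"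
    and square: "\<And>F \<delta>. \<lbrakk>finite F; F \<noteq> {}; F \<subseteq> unit_sphere UNIV; \<delta> > (0::real)\<rbrakk> \<Longrightarrow>
      \<exists>x\<in>A. \<forall>y\<in>F. norm (y + x) \<le> 1 + \<delta> \<and> norm (y - x) \<le> 1 + \<delta>"
    and K: "compact K" "K \<subseteq> cball 0 1"
    and \<delta>: "\<delta> > 0"
  shows "\<exists>x\<in>A. \<forall>z\<in>K. \<forall>t. \<bar>t\<bar> \<le> 1 \<longrightarrow> norm (z + t *\<^sub>R x) \<le> 1 + \<delta>"
proof -
  obtain N where N: "N \<subseteq> K" "finite N" "K \<subseteq> (\<Union>w\<in>N. ball w (\<delta>/2))"
    using compactE_image[OF K(1), of K "\<lambda>w. ball w (\<delta>/2)"] \<delta> by force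
  obtain v :: 'a where "v \<noteq> 0"
    using nontrivial by blast
  then obtain u :: 'a where u: "norm u = 1"
    using norm_sgn[of v] by auto
  \<comment> \<open>The vector \<open>u\<close> only keeps the finite set non-empty when every net point is zero.\<close>
  define F where "F = insert u (sgn ` (N - {0}))"
  have "finite F" "F \<noteq> {}" "F \<subseteq> unit_sphere UNIV" "\<delta>/2 > 0"
    using N(2) u \<delta> by (auto simp: F_def unit_sphere_def norm_sgn)
  from square[OF this] obtain x where x: "x \<in> A"
    and F_le: "\<forall>v\<in>F. norm (v + x) \<le> 1 + \<delta>/2 \<and> norm (v - x) \<le> 1 + \<delta>/2" ..
  have "norm (z + t *\<^sub>R x) \<le> 1 + \<delta>" if z: "z \<in> K" and t: "\<bar>t\<bar> \<le> 1" for z t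
  proof -
    obtain w where w: "w \<in> N" "dist w z < \<delta>/2"
      using N(3) z by auto
    have "norm (w + t *\<^sub>R x) \<le> 1 + \<delta>/2"
    proof (rule norm_add_scaled_le_of_normalised)
      show "norm x = 1" using x A by (auto simp: unit_sphere_def)
      show "norm w \<le> 1" using w(1) N(1) K(2) by auto
      show "norm (sgn w + x) \<le> 1 + \<delta>/2 \<and> norm (sgn w - x) \<le> 1 + \<delta>/2" if "w \<noteq> 0"
        using F_le w(1) that by (simp add: F_def)
    qed (use t \<delta> in simp_all)
    moreover have "norm (z + t *\<^sub>R x) \<le> norm (w + t *\<^sub>R x) + norm (z - w)"
      using norm_triangle_ineq[of "w + t *\<^sub>R x" "z - w"] by (simp add: add.commute)
    ultimately show ?thesis
      using w(2) by (simp add: dist_norm norm_minus_commute)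
  qed
  then show ?thesis using x by blast
qed

text \<open>The tensor \<open>1 \<otimes> y\<close> over the scalar field stands for evaluation at \<open>y\<close>, so the second factor
  is the norm of \<open>y\<close> in the bidual.\<close>

lemma norm_elementary_tensor:
  fixes x :: "'a::real_normed_vector" and y :: "'b::real_normed_vector"
  shows "norm (elementary_tensor x y) = norm x * norm (elementary_tensor (1::real) y)"
proof -
  have "bounded_linear (\<lambda>f::'b dual. blinfun_apply f y)"
    by (rule blinfun.bounded_linear_left)
  then show ?thesis
    by (simp add: norm_blinfun.rep_eq elementary_tensor.rep_eq onorm_scaleR_left mult.commute)
qed

text \<open>The operator \<open>1 \<otimes> y\<close> is evaluation at \<open>y\<close>, an element of the bidual. It is linear in \<open>y\<close> and
  does not vanish at every \<open>y\<close>, so scaling makes its norm one.\<close>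

lemma exists_evaluation_norm_one:
  fixes f :: "'b::real_normed_vector dual"
  assumes "f \<noteq> 0"
  shows "\<exists>y::'b. norm (elementary_tensor (1::real) y) = 1"
proof -
  obtain y where y: "blinfun_apply f y \<noteq> 0"
    using assms by (metis blinfun_eqI zero_blinfun.rep_eq)
  define e :: "'b \<Rightarrow> 'b dual \<Rightarrow>\<^sub>L real" where "e = elementary_tensor 1"
  have "e y \<noteq> 0"
    using y by (metis e_def elementary_tensor.rep_eq mult.right_neutral real_scaleR_def
        zero_blinfun.rep_eq)
  moreover have "e (c *\<^sub>R y) = c *\<^sub>R e y" for c
    unfolding e_def
    by (rule blinfun_eqI) (simp add: elementary_tensor.rep_eq blinfun.scaleR_right scaleR_blinfun.rep_eq)
  ultimately have "norm (e ((1 / norm (e y)) *\<^sub>R y)) = 1"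
    by simp
  then show ?thesis unfolding e_def by blast
qed

theorem proposition2p7:
  fixes H :: "('b::banach dual \<Rightarrow>\<^sub>L 'a::banach) set"
  assumes "(UNIV :: 'a set) \<noteq> {0}"
    and "(UNIV :: 'b set) \<noteq> {0}"
    and "subspace H"
    and "closed H"
    and "H \<subseteq> compact_operators"
    and "algebraic_tensor (UNIV :: 'a set) (UNIV :: 'b set) \<subseteq> H"
    and "uasq (UNIV :: 'a set)"
  shows "uasq H"
proof (cases "\<exists>f :: 'b dual. f \<noteq> 0")
  case False
  then have "T = 0" for T :: "'b dual \<Rightarrow>\<^sub>L 'a"
    by (intro blinfun_eqI) (metis blinfun.zero_right)
  then have "norm T \<noteq> 1" for T :: "'b dual \<Rightarrow>\<^sub>L 'a"
    by (metis norm_zero zero_neq_one)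
  then have "unit_sphere H = {}"
    by (simp add: unit_sphere_def)
  then show ?thesis unfolding uasq_def by auto
next
  case True
  then obtain y :: 'b where y: "norm (elementary_tensor (1::real) y) = 1"
    using exists_evaluation_norm_one by blast
  define E :: "'a \<Rightarrow> 'b dual \<Rightarrow>\<^sub>L 'a" where "E x = elementary_tensor x y" for x
  have E_apply: "blinfun_apply (E x) f = blinfun_apply f y *\<^sub>R x" for x f
    by (simp add: E_def elementary_tensor.rep_eq)
  have E_linear: "linear E"
    by (rule linearI; rule blinfun_eqI)
      (simp_all add: E_apply plus_blinfun.rep_eq scaleR_blinfun.rep_eq scaleR_add_right)
  have E_norm: "norm (E x) = norm x" for x
    using norm_elementary_tensor[of x y] y by (simp add: E_def)
  have E_inj: "inj E"
    using E_linear E_norm by (metis linear_injective_0 norm_eq_zero)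
  have E_mem: "E x \<in> H" for x
    using assms(6) by (auto simp: E_def algebraic_tensor_def intro: span_base)
  have y_le: "\<bar>blinfun_apply f y\<bar> \<le> 1" if "norm f \<le> 1" for f :: "'b dual"
    using norm_blinfun[of "elementary_tensor (1::real) y" f] that y
    by (simp add: elementary_tensor.rep_eq)
  show ?thesis
    unfolding uasq_def
  proof (intro allI impI)
    fix \<epsilon> :: real
    assume "\<epsilon> > 0"
    from assms(7)[unfolded uasq_def, THEN spec, THEN mp, OF this]
    obtain A where A: "A \<subseteq> unit_sphere (UNIV :: 'a set)"
      and nonempty: "\<forall>F \<delta>. finite F \<and> F \<noteq> {} \<and> F \<subseteq> unit_sphere UNIV \<and> \<delta> > 0 \<longrightarrow>
        {x \<in> A. \<forall>y\<in>F. norm (y + x) \<le> 1 + \<delta> \<and> norm (y - x) \<le> 1 + \<delta>} \<noteq> {}"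
      and signs: "\<forall>F \<xi>. finite F \<and> F \<subseteq> A \<and> (\<forall>x\<in>F. \<xi> x \<in> {-1, 1 :: real}) \<longrightarrow>
        norm (\<Sum>x\<in>F. \<xi> x *\<^sub>R x) \<le> 1 + \<epsilon>"
      by (elim exE conjE) (rule that)
    have square: "\<exists>x\<in>A. \<forall>y\<in>F. norm (y + x) \<le> 1 + \<delta> \<and> norm (y - x) \<le> 1 + \<delta>"
      if "finite F" "F \<noteq> {}" "F \<subseteq> unit_sphere UNIV" "\<delta> > 0" for F \<delta>
      using nonempty[rule_format, of F \<delta>] that by auto
    have square_H: "\<exists>S\<in>E ` A. \<forall>T\<in>F. norm (T + S) \<le> 1 + \<delta> \<and> norm (T - S) \<le> 1 + \<delta>"
      if F: "finite F" "F \<subseteq> unit_sphere H" and \<delta>: "\<delta> > 0" for F :: "('b dual \<Rightarrow>\<^sub>L 'a) set" and \<delta>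
    proof -
      define K where "K = (\<Union>T\<in>F. closure (blinfun_apply T ` cball 0 1))"
      have K_compact: "compact K"
        using F assms(5) unfolding K_def
        by (intro compact_UN) (auto simp: unit_sphere_def compact_operators_def)
      have "norm (blinfun_apply T f) \<le> 1" if "T \<in> F" "norm f \<le> 1" for T f
        using norm_blinfun[of T f] that F(2) by (auto simp: unit_sphere_def)
      then have K_cball: "K \<subseteq> cball 0 1"
        unfolding K_def by (intro UN_least closure_minimal) auto
      obtain x where x: "x \<in> A"
        and x_le: "\<forall>z\<in>K. \<forall>t. \<bar>t\<bar> \<le> 1 \<longrightarrow> norm (z + t *\<^sub>R x) \<le> 1 + \<delta>"
        using almost_square_on_compact[OF assms(1) A square K_compact K_cball \<delta>] ..
      \<comment> \<open>A general coefficient \<open>s\<close> treats \<open>T + E x\<close> and \<open>T - E x\<close> at once.\<close>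
      have "norm (T + s *\<^sub>R E x) \<le> 1 + \<delta>" if T: "T \<in> F" and s: "\<bar>s\<bar> \<le> 1" for T s
      proof (rule norm_blinfun_bound)
        fix f :: "'b dual"
        have "norm (blinfun_apply (T + s *\<^sub>R E x) (sgn f)) \<le> 1 + \<delta>"
        proof -
          have "norm (sgn f) \<le> 1" by (simp add: norm_sgn)
          then have "\<bar>s * blinfun_apply (sgn f) y\<bar> \<le> 1"
            using s y_le[of "sgn f"] by (simp add: abs_mult mult_le_one)
          moreover from \<open>norm (sgn f) \<le> 1\<close>
          have "blinfun_apply T (sgn f) \<in> blinfun_apply T ` cball 0 1" by simp
          then have "blinfun_apply T (sgn f) \<in> K"
            unfolding K_def by (intro UN_I[OF T] subsetD[OF closure_subset])
          ultimately show ?thesis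
            using x_le[rule_format, of "blinfun_apply T (sgn f)" "s * blinfun_apply (sgn f) y"]
            by (simp add: E_apply plus_blinfun.rep_eq scaleR_blinfun.rep_eq)
        qed
        then have "norm f * norm (blinfun_apply (T + s *\<^sub>R E x) (sgn f)) \<le> norm f * (1 + \<delta>)"
          by (rule mult_left_mono) simp
        moreover have f_eq: "f = norm f *\<^sub>R sgn f"
          by (cases "f = 0") (simp_all add: sgn_div_norm)
        have "norm (blinfun_apply (T + s *\<^sub>R E x) f)
            = norm f * norm (blinfun_apply (T + s *\<^sub>R E x) (sgn f))"
          by (subst f_eq) (simp only: blinfun.scaleR_right norm_scaleR abs_norm_cancel)
        ultimately show "norm (blinfun_apply (T + s *\<^sub>R E x) f) \<le> (1 + \<delta>) * norm f"
          by (simp add: mult.commute)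
      qed (use \<delta> in simp)
      from this[of _ 1] this[of _ "- 1"] show ?thesis using x by force
    qed
    have signs_H: "norm (\<Sum>S\<in>F. \<xi> S *\<^sub>R S) \<le> 1 + \<epsilon>"
      if F: "finite F" "F \<subseteq> E ` A" and \<xi>: "\<forall>S\<in>F. \<xi> S \<in> {-1, 1 :: real}" for F \<xi>
    proof -
      obtain G where G: "G \<subseteq> A" "finite G" "F = E ` G"
        using finite_subset_image[OF F] by blast
      have "(\<Sum>S\<in>F. \<xi> S *\<^sub>R S) = E (\<Sum>x\<in>G. \<xi> (E x) *\<^sub>R x)"
        using E_inj by (simp add: G(3) sum.reindex inj_on_subset linear_sum[OF E_linear]
            linear_scale[OF E_linear])
      then show ?thesis
        using signs[rule_format, of G "\<lambda>x. \<xi> (E x)"] G \<xi> by (simp add: E_norm)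
    qed
    have sphere_H: "E ` A \<subseteq> unit_sphere H"
      using A by (auto simp: unit_sphere_def E_norm E_mem)
    show "\<exists>A\<subseteq>unit_sphere H.
       (\<forall>F \<delta>. finite F \<and> F \<noteq> {} \<and> F \<subseteq> unit_sphere H \<and> \<delta> > 0 \<longrightarrow>
          {x \<in> A. \<forall>y\<in>F. norm (y + x) \<le> 1 + \<delta> \<and> norm (y - x) \<le> 1 + \<delta>} \<noteq> {}) \<and>
       (\<forall>F \<xi>. finite F \<and> F \<subseteq> A \<and> (\<forall>x\<in>F. \<xi> x \<in> {-1, 1 :: real}) \<longrightarrow>
          norm (\<Sum>x\<in>F. \<xi> x *\<^sub>R x) \<le> 1 + \<epsilon>)"
    proof (intro exI[of _ "E ` A"] conjI allI impI)
      fix F :: "('b dual \<Rightarrow>\<^sub>L 'a) set" and \<delta> :: real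
      assume "finite F \<and> F \<noteq> {} \<and> F \<subseteq> unit_sphere H \<and> \<delta> > 0"
      then show "{S \<in> E ` A. \<forall>T\<in>F. norm (T + S) \<le> 1 + \<delta> \<and> norm (T - S) \<le> 1 + \<delta>} \<noteq> {}"
        using square_H[of F \<delta>] by blast
    next
      fix F :: "('b dual \<Rightarrow>\<^sub>L 'a) set" and \<xi> :: "('b dual \<Rightarrow>\<^sub>L 'a) \<Rightarrow> real"
      assume "finite F \<and> F \<subseteq> E ` A \<and> (\<forall>S\<in>F. \<xi> S \<in> {-1, 1})"
      then show "norm (\<Sum>S\<in>F. \<xi> S *\<^sub>R S) \<le> 1 + \<epsilon>"
        using signs_H[of F \<xi>] by simp
    qed (rule sphere_H)
  qed
qed

end
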